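(* For $N\ge1$ let $\omega_1,\dots,\omega_N$ be independent Gaussian random variables with mean zero and unit variance, and let $P_{\mathsf{sync}}(\gamma,N)$ denote the probability that the Kuramoto system $\frac{d}{dt}\theta_i=\omega_i+\gamma\sum_{j=1}^N\sin(\theta_j-\theta_i)$, $i=1,\dots,N$, has a fully synchronous solution. For every $\delta>0$ there exist constants $C_1>0$ and $C_2=C_2(\delta)>0$, independent of $N$, such that $$P_{\mathsf{sync}}(\delta/N,N)\le C_1e^{-C_2(\delta)N}\quad\text{for all }N.$$
   Context: Let $f_i(\theta)=\sum_{j=1}^N\sin(\theta_j-\theta_i)$ for $\theta\in\mathbb{T}^N=(\mathbb{R}/2\pi\mathbb{Z})^N$. Given $\gamma>0$ and $\omega\in\mathbb{R}^N$, pass to the co-rotating frame, i.e. replace $\omega$ by $\tilde\omega_i=\omega_i-\frac1N\sum_k\omega_k$. The system has a fully synchronous solution if there is $\theta\in\mathbb{T}^N$ with $\gamma f(\theta)=-\tilde\omega$ such that the Jacobian matrix $J(\theta)=(\partial f_i/\partial\theta_j)_{i,j}$ is negative semi-definite with a one-dimensional kernel. *)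

theory Defs
  imports "HOL-Probability.Probability" "Jordan_Normal_Form.Matrix_Kernel"
begin

text \<open>
  Oscillators are indexed by \<open>0, \<dots>, N - 1\<close>. A point of the torus \<open>(\<real>/2\<pi>\<int>)\<^sup>N\<close> is given by a
  real representative \<open>\<theta> i\<close>, \<open>i < N\<close>, of each angle; everything below is
  \<open>2\<pi>\<close>-periodic in each of these and independent of \<open>\<theta> i\<close> for \<open>i \<ge> N\<close>.
\<close>

definition kuramoto_f :: "nat \<Rightarrow> (nat \<Rightarrow> real) \<Rightarrow> nat \<Rightarrow> real" where
  "kuramoto_f N \<theta> i = (\<Sum>j<N. sin (\<theta> j - \<theta> i))"

definition kuramoto_jacobian :: "nat \<Rightarrow> (nat \<Rightarrow> real) \<Rightarrow> real mat" where
  "kuramoto_jacobian N \<theta> =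
     mat N N (\<lambda>(i, j). deriv (\<lambda>t. kuramoto_f N (\<theta>(j := t)) i) (\<theta> j))"

definition negative_semidefinite :: "real mat \<Rightarrow> bool" where
  "negative_semidefinite A \<longleftrightarrow>
     A \<in> carrier_mat (dim_row A) (dim_row A) \<and> transpose_mat A = A \<and>
     (\<forall>v \<in> carrier_vec (dim_row A). scalar_prod v (A *\<^sub>v v) \<le> 0)"

definition corotating :: "nat \<Rightarrow> (nat \<Rightarrow> real) \<Rightarrow> nat \<Rightarrow> real" where
  "corotating N \<omega> i = \<omega> i - (\<Sum>k<N. \<omega> k) / real N"

definition fully_synchronous :: "real \<Rightarrow> nat \<Rightarrow> (nat \<Rightarrow> real) \<Rightarrow> bool" where
  "fully_synchronous \<gamma> N \<omega> \<longleftrightarrow>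
     (\<exists>\<theta>. (\<forall>i<N. \<gamma> * kuramoto_f N \<theta> i = - corotating N \<omega> i) \<and>
          negative_semidefinite (kuramoto_jacobian N \<theta>) \<and>
          kernel_dim (kuramoto_jacobian N \<theta>) = 1)"

text \<open>
  The set of frequency vectors admitting a fully synchronous solution is open: on mean-zero
  vectors, \<open>f\<close> is a local diffeomorphism wherever its Jacobian is negative semidefinite with
  one-dimensional kernel. So the event below is measurable whenever \<open>\<gamma> \<noteq> 0\<close> and the \<open>\<omega> i\<close> are
  random variables, and \<open>measure\<close> is its actual probability.
\<close>

definition P_sync :: "'a measure \<Rightarrow> (nat \<Rightarrow> 'a \<Rightarrow> real) \<Rightarrow> real \<Rightarrow> nat \<Rightarrow> real" where
  "P_sync M \<omega> \<gamma> N = measure M {x \<in> space M. fully_synchronous \<gamma> N (\<lambda>i. \<omega> i x)}"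

end

(*
  A sum of N sines is at most N in modulus, so at coupling strength \<delta>/N full synchrony forces every
  frequency to lie within \<delta> of the empirical mean. If that mean is nonnegative, all frequencies are
  at least -\<delta>, otherwise all are at most \<delta>. Each of the two events is an intersection of N
  independent events of probability at most 1 - c, with c > 0 the mass of a Gaussian tail, and
  (1 - c)^N \<le> exp (- c N).
*)
theory Submission
  imports Defs
begin

lemma abs_kuramoto_f_le: "\<bar>kuramoto_f N \<theta> i\<bar> \<le> real N"
proof -
  have "\<bar>kuramoto_f N \<theta> i\<bar> \<le> (\<Sum>j<N. \<bar>sin (\<theta> j - \<theta> i)\<bar>)"
    unfolding kuramoto_f_def by (rule sum_abs)
  also have "\<dots> \<le> (\<Sum>j<N. 1)"
    by (rule sum_mono) (rule abs_sin_le_one)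
  finally show ?thesis by simp
qed

text \<open>The equilibrium equation turns the uniform bound on the sine sum into a bound on the
  frequencies.\<close>

lemma fully_synchronous_imp_abs_corotating_le:
  assumes "fully_synchronous \<gamma> N \<omega>" "i < N"
  shows "\<bar>corotating N \<omega> i\<bar> \<le> \<bar>\<gamma>\<bar> * real N"
proof -
  obtain \<theta> where "\<gamma> * kuramoto_f N \<theta> i = - corotating N \<omega> i"
    using assms by (auto simp: fully_synchronous_def)
  then have "\<bar>corotating N \<omega> i\<bar> = \<bar>\<gamma>\<bar> * \<bar>kuramoto_f N \<theta> i\<bar>"
    by (metis abs_minus_cancel abs_mult)
  also have "\<dots> \<le> \<bar>\<gamma>\<bar> * real N"
    by (intro mult_left_mono abs_kuramoto_f_le) simp
  finally show ?thesis .
qed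

text \<open>The empirical mean couples all frequencies, so closeness to it does not factor over i.
  Splitting by the sign of the mean removes it and leaves two conditions that do factor.\<close>

lemma fully_synchronous_imp_one_sided:
  assumes "fully_synchronous (\<delta> / real N) N \<omega>" "\<delta> \<ge> 0" "N \<ge> 1"
  shows "(\<forall>i<N. \<omega> i \<ge> - \<delta>) \<or> (\<forall>i<N. \<omega> i \<le> \<delta>)"
proof -
  define m where "m = (\<Sum>k<N. \<omega> k) / real N"
  \<comment> \<open>For \<gamma> = \<delta>/N the factor N cancels, which makes the bound uniform in
    N.\<close>
  have "\<bar>\<omega> i - m\<bar> \<le> \<delta>" if "i < N" for i
    using fully_synchronous_imp_abs_corotating_le[OF assms(1) that] assms(2,3)
    by (simp add: corotating_def m_def)
  then show ?thesis
    by (cases "m \<ge> 0") (force simp: abs_le_iff)+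
qed

text \<open>The density vanishes nowhere, so a Gaussian null set is also Lebesgue null.\<close>

lemma measure_density_std_normal_pos:
  assumes "S \<in> sets borel" "emeasure lborel S > 0"
  shows "measure (density lborel (\<lambda>x. ennreal (std_normal_density x))) S > 0"
proof -
  interpret prob_space "density lborel (\<lambda>x. ennreal (std_normal_density x))"
    by (rule prob_space_normal_density) simp
  let ?D = "density lborel (\<lambda>x. ennreal (std_normal_density x))"
  have "measure ?D S \<noteq> 0"
  proof
    assume "measure ?D S = 0"
    then have "S \<in> null_sets ?D"
      using assms by (auto simp: null_sets_def emeasure_eq_measure)
    then have "AE x in lborel. x \<in> S \<longrightarrow> ennreal (std_normal_density x) = 0"
      by (subst (asm) null_sets_density_iff) auto
    then have "AE x in lborel. x \<notin> S"
    proof (rule AE_mp, intro AE_I2 impI notI)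
      fix x assume "x \<in> S \<longrightarrow> ennreal (std_normal_density x) = 0" "x \<in> S"
      moreover have "std_normal_density x > 0" by (simp add: normal_density_pos)
      ultimately show False by simp
    qed
    then have "S \<in> null_sets lborel"
      using assms by (subst AE_iff_null_sets) auto
    then show False using assms by auto
  qed
  then show ?thesis by (simp add: zero_less_measure_iff)
qed

context prob_space
begin

lemma distributed_prob_vimage:
  assumes "distributed M lborel X f" "S \<in> sets borel"
  shows "prob (X -` S \<inter> space M) = measure (density lborel f) S"
  using measure_distr[OF distributed_measurable[OF assms(1)], of S] assms(2)
    distributed_distr_eq_density[OF assms(1)] by simp

text \<open>Independence gives a product of N equal factors, each at most 1 - c \<le> exp (-c). Here
  \<open>c\<close> is any lower bound for the mass that the common law puts outside
  \<open>S\<close>.\<close>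

lemma prob_all_vimage_le_exp:
  assumes "indep_vars (\<lambda>_. borel) X {..<N}" "N \<ge> 1"
    and "\<And>i. i < N \<Longrightarrow> distributed M lborel (X i) f"
    and "prob_space (density lborel f)"
    and "S \<in> sets borel" "c \<le> measure (density lborel f) (- S)"
  shows "prob (\<Inter>i<N. X i -` S \<inter> space M) \<le> exp (- c * real N)"
proof -
  interpret D: prob_space "density lborel f" by fact
  have "D.prob S \<le> 1 - c"
    using D.prob_compl[of S] assms(5,6) by (simp add: Compl_eq_Diff_UNIV)
  also have "\<dots> \<le> exp (- c)"
    using exp_ge_add_one_self[of "- c"] by simp
  finally have "D.prob S \<le> exp (- c)" .
  have "prob (\<Inter>i<N. X i -` S \<inter> space M) = (\<Prod>i<N. prob (X i -` S \<inter> space M))"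
    using assms(1,2,5) by (intro indep_varsD) (auto simp: lessThan_empty_iff)
  also have "\<dots> = D.prob S ^ N"
    using distributed_prob_vimage[OF assms(3) assms(5)] by simp
  also have "\<dots> \<le> exp (- c) ^ N"
    by (rule power_mono) (fact, simp)
  finally show ?thesis by (simp add: exp_of_nat_mult[symmetric] mult.commute)
qed

end

theorem proposition4p5:
  shows "\<exists>C1::real. C1 > 0 \<and> (\<forall>\<delta>::real. \<delta> > 0 \<longrightarrow> (\<exists>C2::real. C2 > 0 \<and>
    (\<forall>N::nat. N \<ge> 1 \<longrightarrow>
      (\<forall>(M :: 'a measure) (\<omega> :: nat \<Rightarrow> 'a \<Rightarrow> real).
        prob_space M \<longrightarrow>
        prob_space.indep_vars M (\<lambda>_. borel) \<omega> {..<N} \<longrightarrow>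
        (\<forall>i<N. distributed M lborel (\<omega> i) (\<lambda>x. ennreal (std_normal_density x))) \<longrightarrow>
        P_sync M \<omega> (\<delta> / real N) N \<le> C1 * exp (- C2 * real N)))))"
\<comment> \<open>The constant 2 counts the two one-sided events.\<close>
proof (rule exI[of _ 2], intro conjI allI impI)
  show "(2::real) > 0" by simp
next
  fix \<delta> :: real assume "\<delta> > 0"
  let ?D = "density lborel (\<lambda>x. ennreal (std_normal_density x))"
  \<comment> \<open>The tails below -\<delta> and above \<delta>. They agree by symmetry, but the
    minimum bounds both without an appeal to it. It depends on \<delta> alone, as C2 must.\<close>
  define c where "c = min (measure ?D (- {- \<delta>..})) (measure ?D (- {..\<delta>}))"
  have D: "prob_space ?D" by (rule prob_space_normal_density) simp
  have pos: "emeasure lborel S > 0" if "{a..a + 1} \<subseteq> S" "S \<in> sets borel" for S and a :: real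
    using emeasure_mono[of "{a..a + 1}" S lborel] that
    by (auto intro: less_le_trans[of _ 1])
  have "c > 0"
    unfolding c_def min_less_iff_conj
    \<comment> \<open>The unit intervals [-\<delta> - 2, -\<delta> - 1] and
      [\<delta> + 1, \<delta> + 2] lie inside the two tails.\<close>
    by (intro conjI measure_density_std_normal_pos pos[of "- \<delta> - 2"] pos[of "\<delta> + 1"]) auto
  show "\<exists>C2::real. C2 > 0 \<and>
    (\<forall>N::nat. N \<ge> 1 \<longrightarrow>
      (\<forall>(M :: 'a measure) (\<omega> :: nat \<Rightarrow> 'a \<Rightarrow> real).
        prob_space M \<longrightarrow>
        prob_space.indep_vars M (\<lambda>_. borel) \<omega> {..<N} \<longrightarrow>
        (\<forall>i<N. distributed M lborel (\<omega> i) (\<lambda>x. ennreal (std_normal_density x))) \<longrightarrow>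
        P_sync M \<omega> (\<delta> / real N) N \<le> 2 * exp (- C2 * real N)))"
  proof (intro exI[of _ c] conjI allI impI)
    show "c > 0" by fact
  next
    fix N :: nat and M :: "'a measure" and \<omega> :: "nat \<Rightarrow> 'a \<Rightarrow> real"
    assume N: "N \<ge> 1" and M: "prob_space M"
      and indep: "prob_space.indep_vars M (\<lambda>_. borel) \<omega> {..<N}"
      and dist: "\<forall>i<N. distributed M lborel (\<omega> i) (\<lambda>x. ennreal (std_normal_density x))"
    interpret prob_space M by fact
    define E where "E S = (\<Inter>i<N. \<omega> i -` S \<inter> space M)" for S
    have E_sets: "E S \<in> events" if "S \<in> sets borel" for S
    proof -
      have "\<omega> i -` S \<inter> space M \<in> events" if "i < N" for i
        using indep that \<open>S \<in> sets borel\<close>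
        by (auto simp: indep_vars_def intro: measurable_sets[of _ M borel])
      \<comment> \<open>\<open>N \<ge> 1\<close> matters: over an empty index set the intersection
        would be \<open>UNIV\<close>.\<close>
      then show ?thesis
        unfolding E_def using N by (intro sets.finite_INT) (auto simp: lessThan_empty_iff)
    qed
    \<comment> \<open>Monotonicity of the measure asks for a measurable larger set, which
      \<open>E_sets\<close> supplies.\<close>
    have "P_sync M \<omega> (\<delta> / real N) N \<le> prob (E {- \<delta>..} \<union> E {..\<delta>})"
      unfolding P_sync_def
    proof (rule finite_measure_mono)
      show "{x \<in> space M. fully_synchronous (\<delta> / real N) N (\<lambda>i. \<omega> i x)} \<subseteq> E {- \<delta>..} \<union> E {..\<delta>}"
      proof
        fix x assume x: "x \<in> {x \<in> space M. fully_synchronous (\<delta> / real N) N (\<lambda>i. \<omega> i x)}"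
        then have "(\<forall>i<N. \<omega> i x \<ge> - \<delta>) \<or> (\<forall>i<N. \<omega> i x \<le> \<delta>)"
          using \<open>\<delta> > 0\<close> N by (intro fully_synchronous_imp_one_sided) auto
        then show "x \<in> E {- \<delta>..} \<union> E {..\<delta>}"
          using x by (auto simp: E_def)
      qed
    qed (intro sets.Un E_sets; simp)
    also have "\<dots> \<le> prob (E {- \<delta>..}) + prob (E {..\<delta>})"
      by (intro measure_Un_le E_sets) auto
    \<comment> \<open>As a minimum, \<open>c\<close> is at most the mass of the complement of either
      half-line.\<close>
    also have "\<dots> \<le> exp (- c * real N) + exp (- c * real N)"
      unfolding E_def using dist
      by (intro add_mono prob_all_vimage_le_exp[OF indep N _ D]) (auto simp: c_def)
    finally show "P_sync M \<omega> (\<delta> / real N) N \<le> 2 * exp (- c * real N)" by simp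
  qed
qed

end
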